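(* For every integer $k\ge 1$, $$G_{1\text{-}3\text{-}2}^{k(k-1)\ldots 1}(x)=x^kC^{k+1}(x),$$ where $G_{1\text{-}3\text{-}2}^{k(k-1)\ldots 1}(x)$ is the ordinary generating function $\sum_{n\ge 1}N(n)x^n$, with $N(n)$ the number of permutations of $\{1,\dots,n\}$ that avoid the classical pattern $1\text{-}3\text{-}2$ and begin with the pattern $k(k-1)\ldots 1$.
   Context: A permutation $\pi=\pi_1\cdots\pi_n$ avoids the classical pattern $1\text{-}3\text{-}2$ if there are no indices $a<b<c$ with $\pi_a<\pi_c<\pi_b$. It begins with the pattern $k(k-1)\ldots 1$ if $n\ge k$ and $\pi_1>\pi_2>\cdots>\pi_k$. The empty permutation is not counted. $C(x)=\sum_{n\ge0}C_nx^n=\frac{1-\sqrt{1-4x}}{2x}$ is the generating function of the Catalan numbers $C_n$, and $C^j(x)=(C(x))^j$. *)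

theory Defs
  imports
    Complex_Main
    "HOL-Combinatorics.Multiset_Permutations"
    "HOL-Computational_Algebra.Formal_Power_Series"
begin

text \<open>
  A permutation \<open>\<pi>\<close> of \<open>{1..n}\<close> is its one-line word \<open>\<pi>\<^sub>1 \<dots> \<pi>\<^sub>n\<close>, an element of
  \<^term>\<open>permutations_of_set {1..n}\<close>. List positions start at 0, so \<open>\<pi>\<^sub>i\<close> is \<open>p ! (i - 1)\<close>.
\<close>

definition avoids_132 :: "nat list \<Rightarrow> bool" where
  "avoids_132 p \<longleftrightarrow>
     \<not> (\<exists>a b c. a < b \<and> b < c \<and> c < length p \<and> p ! a < p ! c \<and> p ! c < p ! b)"

text \<open>The condition \<open>n \<ge> k\<close> and \<open>\<pi>\<^sub>1 > \<pi>\<^sub>2 > \<dots> > \<pi>\<^sub>k\<close>.\<close>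

definition begins_decreasing :: "nat \<Rightarrow> nat list \<Rightarrow> bool" where
  "begins_decreasing k p \<longleftrightarrow> k \<le> length p \<and> (\<forall>i. Suc i < k \<longrightarrow> p ! i > p ! Suc i)"

definition num_132_decreasing :: "nat \<Rightarrow> nat \<Rightarrow> nat" where
  "num_132_decreasing k n =
     card {p \<in> permutations_of_set {1..n}. avoids_132 p \<and> begins_decreasing k p}"

text \<open>The empty permutation is not counted, so the constant coefficient is 0.\<close>

definition G_132_decreasing :: "nat \<Rightarrow> real fps" where
  "G_132_decreasing k =
     Abs_fps (\<lambda>n. if n = 0 then 0 else of_nat (num_132_decreasing k n))"

definition catalan :: "nat \<Rightarrow> nat" where
  "catalan n = ((2 * n) choose n) div (n + 1)"

definition catalan_fps :: "real fps" where
  "catalan_fps = Abs_fps (\<lambda>n. of_nat (catalan n))"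

lemma Suc_times_catalan: "(n + 1) * catalan n = (2 * n) choose n"
proof -
  have "Suc n * ((2 * n) choose Suc n) = n * ((2 * n) choose n)"
    unfolding binomial_absorption binomial_absorb_comp[symmetric] by simp
  hence "Suc n dvd n * ((2 * n) choose n)"
    by (metis dvd_triv_left)
  moreover have "coprime (Suc n) n"
    by simp
  ultimately have "Suc n dvd ((2 * n) choose n)"
    using coprime_dvd_mult_right_iff by blast
  thus ?thesis
    unfolding catalan_def Suc_eq_plus1 by (rule dvd_mult_div_cancel)
qed

lemma catalan_Suc: "(n + 2) * catalan (Suc n) = (4 * n + 2) * catalan n"
proof -
  have sym: "(Suc (2 * n) choose n) = (Suc (2 * n) choose Suc n)"
    using binomial_symmetric[of n "Suc (2 * n)"] by (simp add: Suc_diff_le)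
  have 1: "Suc n * ((2 * Suc n) choose Suc n) = (2 * n + 2) * (Suc (2 * n) choose n)"
    using Suc_times_binomial[of n "Suc (2 * n)"] by simp
  have 2: "Suc n * (Suc (2 * n) choose n) = (2 * n + 1) * ((2 * n) choose n)"
    using Suc_times_binomial[of n "2 * n"] sym by simp
  have "(2 * Suc n) choose Suc n = 2 * (Suc (2 * n) choose n)"
  proof -
    have "Suc n * ((2 * Suc n) choose Suc n) = Suc n * (2 * (Suc (2 * n) choose n))"
      unfolding 1 by simp
    thus ?thesis by (simp only: mult_cancel1) simp
  qed
  hence "Suc n * ((n + 2) * catalan (Suc n)) = Suc n * (2 * (Suc (2 * n) choose n))"
    using Suc_times_catalan[of "Suc n"] by simp
  also have "\<dots> = 2 * (Suc n * (Suc (2 * n) choose n))"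
    by simp
  also have "\<dots> = 2 * ((2 * n + 1) * (Suc n * catalan n))"
    unfolding 2 using Suc_times_catalan[of n] by simp
  also have "\<dots> = Suc n * ((4 * n + 2) * catalan n)"
    by (simp add: algebra_simps)
  finally show ?thesis
    by (simp only: mult_cancel1) simp
qed

text \<open>The closed form \<open>C(x) = (1 - sqrt (1 - 4x)) / (2x)\<close>.\<close>

lemma catalan_fps_closed_form:
  includes fps_syntax
  shows "catalan_fps = (1 - fps_radical root 2 (1 - 4 * fps_X)) / (2 * fps_X)"
proof -
  define F where "F = 1 - 2 * fps_X * catalan_fps"
  define D where "D = F ^ 2"
  have F0: "F $ 0 = 1"
    by (simp add: F_def fps_mult_nth)
  have FSuc: "F $ Suc n = - 2 * real (catalan n)" for n
    by (simp add: F_def catalan_fps_def mult.assoc numeral_fps_const)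
  have rec: "real (Suc n) * F $ Suc n = (4 * real n - 2) * F $ n" for n
  proof (cases n)
    case 0
    thus ?thesis using F0 FSuc[of 0] by (simp add: catalan_def)
  next
    case (Suc m)
    have "real (m + 2) * real (catalan (Suc m)) = (4 * real m + 2) * real (catalan m)"
      using catalan_Suc[of m, THEN arg_cong[of _ _ real]]
      by (simp only: of_nat_mult of_nat_add of_nat_numeral)
    thus ?thesis
      unfolding Suc FSuc by (simp add: algebra_simps)
  qed
  have dF: "(1 - 4 * fps_X) * fps_deriv F = - 2 * F"
  proof (rule fps_ext)
    fix n
    show "((1 - 4 * fps_X) * fps_deriv F) $ n = (- 2 * F) $ n"
      using rec[of n]
      by (cases n)
         (simp_all add: numeral_fps_const left_diff_distrib mult.assoc fps_mult_nth_0 algebra_simps)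
  qed
  have dD: "(1 - 4 * fps_X) * fps_deriv D = - 4 * D"
  proof -
    have "(1 - 4 * fps_X) * fps_deriv D = 2 * F * ((1 - 4 * fps_X) * fps_deriv F)"
      by (simp add: D_def power2_eq_square algebra_simps)
    also have "\<dots> = - 4 * D"
      unfolding dF by (simp add: D_def power2_eq_square)
    finally show ?thesis .
  qed
  have Drec: "real (Suc n) * D $ Suc n = (4 * real n - 4) * D $ n" for n
    using dD[THEN arg_cong[of _ _ "\<lambda>f. f $ n"]]
    by (cases n)
       (simp_all add: numeral_fps_const left_diff_distrib mult.assoc fps_mult_nth_0 algebra_simps)
  have D0: "D $ 0 = 1"
    by (simp add: D_def F0 power2_eq_square fps_mult_nth_0)
  have D1: "D $ Suc 0 = - 4"
    using Drec[of 0] D0 by simp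
  have D2: "D $ Suc (Suc n) = 0" for n
  proof (induction n)
    case 0
    thus ?case using Drec[of "Suc 0"] by simp
  next
    case (Suc n)
    thus ?case using Drec[of "Suc (Suc n)"] by simp
  qed
  have "D = 1 - 4 * fps_X"
  proof (rule fps_ext)
    fix n
    consider "n = 0" | "n = Suc 0" | m where "n = Suc (Suc m)"
      by (metis not0_implies_Suc)
    thus "D $ n = (1 - 4 * fps_X) $ n"
      by cases (simp_all add: D0 D1 D2 numeral_fps_const)
  qed
  hence "F ^ Suc 1 = 1 - 4 * fps_X"
    by (simp add: D_def numeral_2_eq_2)
  hence "F = fps_radical root (Suc 1) (1 - 4 * fps_X)"
    by (subst (asm) radical_unique[where r = root]) (simp_all add: F0 fps_mult_nth_0)
  hence "fps_radical root 2 (1 - 4 * fps_X) = F"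
    by (simp add: numeral_2_eq_2)
  hence "1 - fps_radical root 2 (1 - 4 * fps_X) = (2 * fps_X) * catalan_fps"
    by (simp add: F_def)
  thus ?thesis
    by simp
qed

end

theory Submission
  imports Defs
begin

text \<open>
  Write a nonempty 1-3-2-avoiding permutation as \<open>\<pi> = L m R\<close> around its largest entry \<open>m\<close>. An
  entry of \<open>L\<close> below an entry of \<open>R\<close> would form 1-3-2 together with \<open>m\<close>, so every entry of \<open>L\<close>
  exceeds every entry of \<open>R\<close>. Conversely, if \<open>L\<close> lies above \<open>R\<close> and both avoid 1-3-2, so does
  \<open>\<pi>\<close>. Thus \<open>\<pi>\<close> amounts to a pair of avoiding permutations (\<open>bij_betw_glue\<close>).

  Let \<open>A\<^sub>k\<close> be the generating function of the avoiding permutations, of any length \<open>n \<ge> 0\<close>, that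
  begin with \<open>k\<close> decreasing entries; for \<open>k = 0\<close> these are all avoiding permutations. The
  decomposition gives \<open>A\<^sub>0 = 1 + x A\<^sub>0\<^sup>2\<close>, an equation with only one power series solution,
  whence \<open>A\<^sub>0 = C\<close>. For the initial decreasing run, note that \<open>L\<close> is followed by an ascent to
  \<open>m\<close> unless it is empty: if \<open>L\<close> is empty, \<open>\<pi>\<close> starts with \<open>k + 1\<close> decreasing entries iff \<open>R\<close>
  starts with \<open>k\<close> of them; otherwise the whole run must lie inside \<open>L\<close>, and \<open>R\<close> is arbitrary.
  Hence \<open>A\<^bsub>k+1\<^esub> = x A\<^sub>k + x A\<^bsub>k+1\<^esub> C\<close>. As \<open>C (1 - x C) = 1\<close>, this says
  \<open>A\<^bsub>k+1\<^esub> = x C A\<^sub>k\<close>, and induction from \<open>A\<^sub>0 = C\<close> yields \<open>A\<^sub>k = x\<^sup>k C\<^bsup>k+1\<^esup>\<close>. For \<open>k \<ge> 1\<close> the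
  empty permutation does not begin with \<open>k\<close> decreasing entries, so leaving it out changes nothing.
\<close>

section \<open>Splitting an avoiding permutation at its maximum\<close>

definition avoiders :: "nat \<Rightarrow> nat list set" where
  "avoiders n = {p \<in> permutations_of_set {1..n}. avoids_132 p}"

text \<open>
  Both arguments are permutations of initial segments \<open>{1..i}\<close> and \<open>{1..j}\<close>; shifting the left one
  by \<open>j\<close> places it above the right one, and \<open>i + j + 1\<close> becomes the maximum.
\<close>

definition glue :: "nat list \<Rightarrow> nat list \<Rightarrow> nat list" where
  "glue L R = map (\<lambda>x. x + length R) L @ Suc (length L + length R) # R"

lemma avoidersD:
  assumes "p \<in> avoiders n"
  shows "distinct p" "set p = {1..n}" "avoids_132 p" "length p = n"
  using assms distinct_card[of p]
  by (auto simp: avoiders_def permutations_of_set_def)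

lemma avoidersI: "distinct p \<Longrightarrow> set p = {1..n} \<Longrightarrow> avoids_132 p \<Longrightarrow> p \<in> avoiders n"
  by (auto simp: avoiders_def permutations_of_set_def)

lemma finite_avoiders: "finite (avoiders n)"
  by (auto simp: avoiders_def)

lemma avoids_132_map_add_iff: "avoids_132 (map (\<lambda>x. x + r) p) \<longleftrightarrow> avoids_132 p"
proof -
  have "map (\<lambda>x. x + r) p ! a < map (\<lambda>x. x + r) p ! c \<and> map (\<lambda>x. x + r) p ! c < map (\<lambda>x. x + r) p ! b
      \<longleftrightarrow> p ! a < p ! c \<and> p ! c < p ! b" if "a < b" "b < c" "c < length p" for a b c
    using that by simp
  thus ?thesis unfolding avoids_132_def by (metis length_map)
qed

lemma avoids_132_append:
  assumes "avoids_132 (xs @ ys)"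
  shows "avoids_132 xs" "avoids_132 ys"
proof -
  let ?p = "xs @ ys"
  have av: False if "a < b" "b < c" "c < length ?p" "?p ! a < ?p ! c" "?p ! c < ?p ! b" for a b c
    using assms that unfolding avoids_132_def by blast
  show "avoids_132 xs"
    unfolding avoids_132_def
  proof safe
    fix a b c assume "a < b" "b < c" "c < length xs" "xs ! a < xs ! c" "xs ! c < xs ! b"
    thus False using av[of a b c] by (simp add: nth_append)
  qed
  show "avoids_132 ys"
    unfolding avoids_132_def
  proof safe
    fix a b c assume "a < b" "b < c" "c < length ys" "ys ! a < ys ! c" "ys ! c < ys ! b"
    thus False
      using av[of "length xs + a" "length xs + b" "length xs + c"] by simp
  qed
qed

text \<open>
  An occurrence of 1-3-2 cannot straddle \<open>m\<close>: the \<open>2\<close> is never the maximum, and if it lies in the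
  low block \<open>R\<close> then the smaller \<open>1\<close> does too.
\<close>

lemma avoids_132_appendI:
  assumes L: "avoids_132 L" and R: "avoids_132 R"
    and LR: "\<And>x y. x \<in> set L \<Longrightarrow> y \<in> set R \<Longrightarrow> y < x"
    and m: "\<And>x. x \<in> set L \<union> set R \<Longrightarrow> x < m"
  shows "avoids_132 (L @ m # R)"
  unfolding avoids_132_def
proof safe
  define p where "p = L @ m # R"
  define l where "l = length L"
  fix a b c
  assume ord: "a < b" "b < c" "c < length (L @ m # R)"
    and "(L @ m # R) ! a < (L @ m # R) ! c" "(L @ m # R) ! c < (L @ m # R) ! b"
  hence pat: "p ! a < p ! c" "p ! c < p ! b" by (simp_all add: p_def)
  have len: "length p = Suc l + length R" by (simp add: p_def l_def)
  have inL: "p ! i = L ! i" if "i < l" for i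
    using that by (simp add: p_def l_def nth_append)
  have inR: "p ! i = R ! (i - Suc l)" if "i > l" for i
    using that by (auto simp: p_def l_def nth_append nth_Cons' Suc_diff_Suc)
  have top: "p ! l = m" by (simp add: p_def l_def)
  consider "c < l" | "c = l" | "c > l" by linarith
  thus False
  proof cases
    case 1
    hence "L ! a < L ! c" "L ! c < L ! b" using ord pat inL[of a] inL[of b] inL[of c] by simp_all
    thus False using L ord 1 unfolding avoids_132_def l_def by blast
  next
    case 2
    hence "p ! b < m" using m[of "L ! b"] ord inL[of b] by (simp add: l_def)
    thus False using pat 2 top by simp
  next
    case 3
    have c: "R ! (c - Suc l) \<in> set R" using 3 ord len by (intro nth_mem) (simp add: p_def)
    have "\<not> a < l"
      using LR[OF _ c, of "L ! a"] pat inL[of a] inR[OF 3] by (auto simp: l_def)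
    moreover have "a \<noteq> l" using m[of "R ! (c - Suc l)"] c pat inR[OF 3] top by auto
    ultimately have "a > l" by simp
    hence "a - Suc l < b - Suc l" "b - Suc l < c - Suc l" "c - Suc l < length R"
      using ord 3 len by (auto simp: p_def)
    moreover have "R ! (a - Suc l) < R ! (c - Suc l)" "R ! (c - Suc l) < R ! (b - Suc l)"
      using pat inR[of a] inR[of b] inR[of c] ord \<open>a > l\<close> by simp_all
    ultimately show False using R unfolding avoids_132_def by blast
  qed
qed

lemma glue_in_avoiders:
  assumes L: "L \<in> avoiders i" and R: "R \<in> avoiders j"
  shows "glue L R \<in> avoiders (Suc (i + j))"
proof (rule avoidersI)
  note L' = avoidersD[OF L] and R' = avoidersD[OF R]
  have img: "(\<lambda>x. x + j) ` {1..i} = {Suc j..i + j}"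
    by simp
  show "set (glue L R) = {1..Suc (i + j)}"
    using L' R' img by (auto simp: glue_def)
  show "distinct (glue L R)"
    using L' R' by (auto simp: glue_def distinct_map)
  show "avoids_132 (glue L R)"
    unfolding glue_def
    by (rule avoids_132_appendI) (use L' R' in \<open>auto simp: avoids_132_map_add_iff\<close>)
qed

text \<open>
  \<open>B\<close> is closed downwards in \<open>{1..n}\<close>. This is what turns "\<open>L\<close> lies above \<open>R\<close>" into the
  knowledge of the exact values that \<open>R\<close>, and hence \<open>L\<close>, uses.
\<close>

lemma lower_part_of_interval:
  fixes A B :: "nat set"
  assumes AB: "A \<union> B = {1..n}" and BA: "\<And>a b. a \<in> A \<Longrightarrow> b \<in> B \<Longrightarrow> b < a"
  shows "B = {1..card B}"
proof (cases "B = {}")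
  case False
  have fin: "finite B" using AB by (metis finite_Un finite_atLeastAtMost)
  have "{1..Max B} \<subseteq> B"
  proof
    fix x assume x: "x \<in> {1..Max B}"
    have "Max B \<in> B" using fin False by simp
    moreover from this have "Max B \<le> n" using AB by auto
    ultimately show "x \<in> B" using x AB BA[of x "Max B"] by fastforce
  qed
  moreover have "B \<subseteq> {1..Max B}" using AB fin by auto
  ultimately have "B = {1..Max B}" by blast
  thus ?thesis by (metis card_atLeastAtMost diff_Suc_1)
qed simp

text \<open>
  Cut at the maximum into \<open>H\<close> and \<open>R\<close>. An entry of \<open>H\<close> below an entry of \<open>R\<close> would complete a
  1-3-2 with the maximum as the \<open>3\<close>, so \<open>R\<close> takes the lowest values and \<open>H\<close> the values directly
  above them; lowering \<open>H\<close> by the length of \<open>R\<close> gives \<open>L\<close>.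
\<close>

lemma avoiders_SucE:
  assumes p: "p \<in> avoiders (Suc n)"
  obtains i L R where "i \<le> n" "L \<in> avoiders i" "R \<in> avoiders (n - i)" "p = glue L R"
proof -
  note p' = avoidersD[OF p]
  have "Suc n \<in> set p" using p' by simp
  then obtain H R where split: "p = H @ Suc n # R" by (meson split_list)
  define r where "r = length R"
  have dist: "distinct H" "distinct R" "set H \<inter> set R = {}" "Suc n \<notin> set H \<union> set R"
    using p'(1) by (auto simp: split)
  have un: "set H \<union> set R = {1..n}"
  proof -
    have "set H \<union> set R = set p - {Suc n}" using dist by (auto simp: split)
    thus ?thesis using p'(2) by auto
  qed
  have above: "y < x" if x: "x \<in> set H" and y: "y \<in> set R" for x y
  proof (rule ccontr)
    assume "\<not> y < x"
    hence xy: "x < y" using dist x y by (cases x y rule: linorder_cases) auto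
    from x obtain a where a: "a < length H" "x = H ! a" by (auto simp: in_set_conv_nth)
    from y obtain c where c: "c < length R" "y = R ! c" by (auto simp: in_set_conv_nth)
    have "y \<in> {1..n}" using un y by blast
    hence "y < Suc n" by simp
    hence "p ! a < p ! (length H + Suc c) \<and> p ! (length H + Suc c) < p ! length H"
      using a c xy by (simp add: split nth_append)
    moreover have "a < length H" "length H < length H + Suc c" "length H + Suc c < length p"
      using a c by (simp_all add: split)
    ultimately show False using p'(3) unfolding avoids_132_def by blast
  qed
  have setR: "set R = {1..r}"
    using lower_part_of_interval[OF un above] dist by (simp add: r_def distinct_card)
  have len: "length H + r = n" using p'(4) by (simp add: split r_def)
  have setH: "set H = {Suc r..n}"
  proof -
    have "set H = (set H \<union> set R) - set R" using dist(3) by blast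
    also have "\<dots> = {1..n} - {1..r}" unfolding un unfolding setR ..
    also have "\<dots> = {Suc r..n}" by auto
    finally show ?thesis .
  qed
  define L where "L = map (\<lambda>x. x - r) H"
  have H: "H = map (\<lambda>x. x + r) L"
    unfolding L_def map_map by (rule map_idI[symmetric]) (auto simp: setH)
  have avR: "avoids_132 H" "avoids_132 R"
    using avoids_132_append[of H "Suc n # R"] avoids_132_append[of "[Suc n]" R] p'(3)
    by (simp_all add: split)
  have "set L = {1..length H}"
  proof -
    have "set L = (\<lambda>x. x - r) ` {1 + r..length H + r}" using setH len by (simp add: L_def)
    also have "\<dots> = {1..length H}"
      unfolding image_add_atLeastAtMost'[symmetric] image_image by simp
    finally show ?thesis .
  qed
  moreover have "distinct L" using dist(1) unfolding H by (simp add: distinct_map)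
  moreover have "avoids_132 L" using avR(1) unfolding H avoids_132_map_add_iff .
  ultimately have "L \<in> avoiders (length H)" by (intro avoidersI)
  moreover have "R \<in> avoiders (n - length H)"
    using dist(2) avR(2) setR len[symmetric] by (intro avoidersI) simp_all
  moreover have "p = glue L R"
  proof -
    have "length L = length H" by (simp add: L_def)
    thus ?thesis unfolding split glue_def using H len by (simp add: r_def)
  qed
  moreover have "length H \<le> n" using len by simp
  ultimately show thesis using that by blast
qed

lemma inj_on_glue:
  "inj_on (\<lambda>(L, R). glue L R) (\<Union>i\<le>n. avoiders i \<times> avoiders (n - i))"
proof (rule inj_onI, clarify)
  fix L R L' R' i i'
  assume L: "L \<in> avoiders i" "R \<in> avoiders (n - i)"
    and L': "L' \<in> avoiders i'" "R' \<in> avoiders (n - i')"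
    and le: "i \<le> n" "i' \<le> n" and eq: "glue L R = glue L' R'"
  note len = avoidersD(2,4)[OF L(1)] avoidersD(2,4)[OF L(2)]
    avoidersD(2,4)[OF L'(1)] avoidersD(2,4)[OF L'(2)]
  define H H' where "H = map (\<lambda>x. x + length R) L" and "H' = map (\<lambda>x. x + length R') L'"
  have "H @ Suc n # R = H' @ Suc n # R'"
    using eq len le by (simp add: glue_def H_def H'_def)
  \<comment> \<open>The maximum occurs only once, so it marks where both words split.\<close>
  moreover have "Suc n \<notin> set H" "Suc n \<notin> set R"
    using len le by (auto simp: H_def)
  ultimately have "H = H' \<and> R = R'"
    by (metis append_Cons_eq_iff)
  thus "L = L' \<and> R = R'"
    by (auto simp: H_def H'_def inj_map_eq_map)
qed

lemma bij_betw_glue: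
  "bij_betw (\<lambda>(L, R). glue L R) (\<Union>i\<le>n. avoiders i \<times> avoiders (n - i)) (avoiders (Suc n))"
  unfolding bij_betw_def
proof (intro conjI inj_on_glue equalityI subsetI)
  fix p assume "p \<in> (\<lambda>(L, R). glue L R) ` (\<Union>i\<le>n. avoiders i \<times> avoiders (n - i))"
  then obtain i L R where "i \<le> n" "L \<in> avoiders i" "R \<in> avoiders (n - i)" "p = glue L R"
    by auto
  thus "p \<in> avoiders (Suc n)" using glue_in_avoiders[of L i R "n - i"] by simp
next
  fix p assume "p \<in> avoiders (Suc n)"
  then obtain i L R where "i \<le> n" "L \<in> avoiders i" "R \<in> avoiders (n - i)" "p = glue L R"
    by (rule avoiders_SucE)
  thus "p \<in> (\<lambda>(L, R). glue L R) ` (\<Union>i\<le>n. avoiders i \<times> avoiders (n - i))"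
    by force
qed

section \<open>The initial decreasing run\<close>

lemma begins_decreasing_0 [simp]: "begins_decreasing 0 p"
  by (simp add: begins_decreasing_def)

lemma begins_decreasing_Suc_Nil [simp]: "\<not> begins_decreasing (Suc k) []"
  by (simp add: begins_decreasing_def)

lemma begins_decreasing_Suc_Cons:
  assumes "\<And>x. x \<in> set R \<Longrightarrow> x < m"
  shows "begins_decreasing (Suc k) (m # R) \<longleftrightarrow> begins_decreasing k R"
proof -
  have "(\<forall>i. i < k \<longrightarrow> (m # R) ! Suc i < (m # R) ! i) \<longleftrightarrow>
        (\<forall>i. Suc i < k \<longrightarrow> R ! Suc i < R ! i)" if "k \<le> length R"
  proof safe
    fix i assume "\<forall>i. i < k \<longrightarrow> (m # R) ! Suc i < (m # R) ! i" "Suc i < k"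
    thus "R ! Suc i < R ! i" by (auto dest: spec[of _ "Suc i"])
  next
    fix i assume "\<forall>i. Suc i < k \<longrightarrow> R ! Suc i < R ! i" "i < k"
    thus "(m # R) ! Suc i < (m # R) ! i"
      using that assms[OF nth_mem[of 0 R]] by (cases i; cases R) auto
  qed
  thus ?thesis by (auto simp: begins_decreasing_def)
qed

text \<open>
  The step from the last entry of \<open>L\<close> up to \<open>m\<close> is an ascent, so an initial decreasing run of
  the word cannot leave \<open>L\<close>.
\<close>

lemma begins_decreasing_append:
  assumes "L \<noteq> []" and "\<And>x. x \<in> set L \<Longrightarrow> x < m"
  shows "begins_decreasing (Suc k) (L @ m # R) \<longleftrightarrow> begins_decreasing (Suc k) L"
proof
  assume bd: "begins_decreasing (Suc k) (L @ m # R)"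
  have "Suc k \<le> length L"
  proof (rule ccontr)
    assume "\<not> Suc k \<le> length L"
    hence "Suc (length L - 1) < Suc k" using assms(1) by (cases L) auto
    hence "(L @ m # R) ! Suc (length L - 1) < (L @ m # R) ! (length L - 1)"
      using bd unfolding begins_decreasing_def by blast
    hence "m < L ! (length L - 1)" using assms(1) by (simp add: nth_append)
    moreover have "L ! (length L - 1) < m" using assms by simp
    ultimately show False by simp
  qed
  thus "begins_decreasing (Suc k) L"
    using bd by (auto simp: begins_decreasing_def nth_append split: if_splits)
next
  assume "begins_decreasing (Suc k) L"
  thus "begins_decreasing (Suc k) (L @ m # R)"
    by (auto simp: begins_decreasing_def nth_append)
qed

lemma begins_decreasing_map_add:
  "begins_decreasing k (map (\<lambda>x. x + r) L) \<longleftrightarrow> begins_decreasing k L"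
  by (auto simp: begins_decreasing_def)

lemma begins_decreasing_glue:
  assumes "L \<in> avoiders i" "R \<in> avoiders j"
  shows "begins_decreasing (Suc k) (glue L R) \<longleftrightarrow>
    (if L = [] then begins_decreasing k R else begins_decreasing (Suc k) L)"
proof (cases "L = []")
  case True
  thus ?thesis
    using avoidersD[OF assms(2)] begins_decreasing_Suc_Cons[of R "Suc (length R)" k]
    by (simp add: glue_def less_Suc_eq_le)
next
  case False
  have "begins_decreasing (Suc k) (glue L R) \<longleftrightarrow>
      begins_decreasing (Suc k) (map (\<lambda>x. x + length R) L)"
    unfolding glue_def
    by (rule begins_decreasing_append) (use False avoidersD[OF assms(1)] in auto)
  thus ?thesis using False by (simp add: begins_decreasing_map_add)
qed

section \<open>Recurrences for the numbers of permutations\<close>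

lemma num_132_decreasing_eq:
  "num_132_decreasing k n = card {p \<in> avoiders n. begins_decreasing k p}"
  by (simp add: num_132_decreasing_def avoiders_def conj_assoc)

lemma avoiders_0: "avoiders 0 = {[]}"
  by (auto simp: avoiders_def avoids_132_def)

lemma card_avoiders: "card (avoiders n) = num_132_decreasing 0 n"
  by (simp add: num_132_decreasing_eq)

lemma num_132_decreasing_0_0: "num_132_decreasing 0 0 = 1"
  by (simp flip: card_avoiders add: avoiders_0)

lemma num_132_decreasing_Suc_0: "num_132_decreasing (Suc k) 0 = 0"
  by (simp add: num_132_decreasing_eq avoiders_0)

text \<open>
  The product terms are disjoint for different \<open>i\<close>, because \<open>i\<close> is the length of the first component.
  Restricting that component to \<open>X i\<close> allows for a condition on \<open>L\<close> alone.
\<close>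

lemma card_UN_avoiders_Times:
  assumes "\<And>i. X i \<subseteq> avoiders i"
  shows "card (\<Union>i\<le>n. X i \<times> avoiders (n - i)) = (\<Sum>i\<le>n. card (X i) * num_132_decreasing 0 (n - i))"
proof -
  have "finite (X i)" for i using assms finite_avoiders by (rule finite_subset)
  moreover have "(X i \<times> avoiders (n - i)) \<inter> (X j \<times> avoiders (n - j)) = {}" if "i \<noteq> j" for i j
    using that assms avoidersD(4) by blast
  ultimately show ?thesis
    by (subst card_UN_disjoint) (auto simp: finite_avoiders card_cartesian_product card_avoiders)
qed

lemma num_132_decreasing_0_Suc:
  "num_132_decreasing 0 (Suc n) = (\<Sum>i\<le>n. num_132_decreasing 0 i * num_132_decreasing 0 (n - i))"
  using bij_betw_same_card[OF bij_betw_glue[of n]] card_UN_avoiders_Times[of avoiders n]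
  by (simp add: card_avoiders)

text \<open>
  The first summand counts the permutations that start with their maximum (\<open>L\<close> empty), where one
  entry of the run is used up. In the sum \<open>L\<close> has length \<open>i\<close> and contains the whole run; the
  term for \<open>i = 0\<close> vanishes, so no permutation is counted twice.
\<close>

lemma num_132_decreasing_Suc_Suc:
  "num_132_decreasing (Suc k) (Suc n) = num_132_decreasing k n +
     (\<Sum>i\<le>n. num_132_decreasing (Suc k) i * num_132_decreasing 0 (n - i))"
proof -
  define f where "f = (\<lambda>(L, R). glue L R)"
  define D where "D = (\<Union>i\<le>n. avoiders i \<times> avoiders (n - i))"
  define X where "X = (\<lambda>i. {L \<in> avoiders i. begins_decreasing (Suc k) L})"
  define Y where "Y = {[] :: nat list} \<times> {R \<in> avoiders n. begins_decreasing k R}"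
  \<comment> \<open>\<open>Y\<close> and \<open>Z\<close> are the pairs with empty and with nonempty left part.\<close>
  define Z where "Z = (\<Union>i\<le>n. X i \<times> avoiders (n - i))"
  have bij: "bij_betw f D (avoiders (Suc n))"
    unfolding f_def D_def by (rule bij_betw_glue)
  have finD: "finite D" by (auto simp: D_def finite_avoiders)
  have sub: "Y \<union> Z \<subseteq> D"
    by (force simp: D_def Y_def Z_def X_def avoiders_0)
  have len0: "i = 0" if "[] \<in> avoiders i" for i
    using avoidersD(4)[OF that] by simp
  have "f ` (Y \<union> Z) = {p \<in> avoiders (Suc n). begins_decreasing (Suc k) p}"
  proof -
    have mem: "x \<in> Y \<union> Z \<longleftrightarrow> begins_decreasing (Suc k) (f x)" if xD: "x \<in> D" for x
    proof -
      obtain i L R where x: "x = (L, R)" "i \<le> n" "L \<in> avoiders i" "R \<in> avoiders (n - i)"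
        using xD by (auto simp: D_def)
      show ?thesis
      proof (cases "L = []")
        case True
        thus ?thesis using x len0[of i] begins_decreasing_glue[OF x(3,4), of k]
          by (auto simp: f_def Y_def Z_def X_def)
      next
        case False
        thus ?thesis using x begins_decreasing_glue[OF x(3,4), of k] avoidersD(4)
          by (auto simp: f_def Y_def Z_def X_def)
      qed
    qed
    have "f ` (Y \<union> Z) = {p \<in> f ` D. begins_decreasing (Suc k) p}"
      using mem sub by blast
    thus ?thesis using bij by (simp add: bij_betw_def)
  qed
  hence "num_132_decreasing (Suc k) (Suc n) = card (f ` (Y \<union> Z))"
    by (simp add: num_132_decreasing_eq)
  also have "\<dots> = card (Y \<union> Z)"
    using bij sub by (intro card_image) (auto simp: bij_betw_def intro: inj_on_subset)
  also have "\<dots> = card Y + card Z"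
  proof (rule card_Un_disjoint)
    show "finite Y" "finite Z" using sub finD by (auto intro: finite_subset)
    show "Y \<inter> Z = {}" by (auto simp: Y_def Z_def X_def)
  qed
  also have "card Y = num_132_decreasing k n"
    by (simp add: card_cartesian_product Y_def num_132_decreasing_eq)
  also have "card Z = (\<Sum>i\<le>n. num_132_decreasing (Suc k) i * num_132_decreasing 0 (n - i))"
    unfolding Z_def by (subst card_UN_avoiders_Times) (auto simp: X_def num_132_decreasing_eq)
  finally show ?thesis .
qed

section \<open>Generating functions\<close>

text \<open>Clearing denominators in the closed form and squaring away the root.\<close>

lemma catalan_fps_eq: "catalan_fps = 1 + fps_X * catalan_fps ^ 2"
proof -
  define S :: "real fps" where "S = fps_radical root 2 (1 - 4 * fps_X)"
  have S0: "fps_nth S 0 = 1"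
    by (simp add: S_def)
  have "S ^ Suc 1 = 1 - 4 * fps_X"
    using power_radical[of "1 - 4 * fps_X" root 1]
    by (simp add: S_def numeral_2_eq_2 fps_mult_nth_0)
  hence S2: "S ^ 2 = 1 - 4 * fps_X" by (simp add: numeral_2_eq_2)
  \<comment> \<open>The quotient in the closed form is exact, as \<open>1 - S\<close> has no constant term.\<close>
  have "fps_X * fps_shift 1 (1 - S) = 1 - S"
    by (rule fps_ext) (auto simp: S0 fps_X_mult_nth gr0_conv_Suc)
  also have "fps_X = 2 * fps_X * fps_const (1 / 2 :: real)"
    by (simp add: numeral_fps_const mult.commute mult.left_commute)
  finally have "2 * fps_X dvd 1 - S"
    by (metis dvd_triv_left mult.assoc)
  hence "2 * fps_X * catalan_fps = 1 - S"
    unfolding catalan_fps_closed_form S_def by (rule dvd_mult_div_cancel)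
  hence "(1 - 2 * fps_X * catalan_fps) ^ 2 = 1 - 4 * fps_X"
    using S2 by simp
  hence "4 * fps_X * catalan_fps = 4 * fps_X * (1 + fps_X * catalan_fps ^ 2)"
    by (simp add: power2_eq_square algebra_simps)
  moreover have "4 * fps_X \<noteq> (0 :: real fps)" by simp
  ultimately show ?thesis by (metis mult_left_cancel)
qed

text \<open>
  The difference of two solutions of \<open>A = 1 + x A\<^sup>2\<close> is annihilated by a power series with
  constant coefficient 1, hence is 0.
\<close>

lemma eq_catalan_fpsI:
  assumes A: "A = 1 + fps_X * A ^ 2"
  shows "A = catalan_fps"
proof -
  have "(A - catalan_fps) * (1 - fps_X * (A + catalan_fps)) =
      (A - fps_X * A ^ 2) - (catalan_fps - fps_X * catalan_fps ^ 2)"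
    by (simp add: algebra_simps power2_eq_square)
  also have "\<dots> = 0"
    using A catalan_fps_eq by (metis add_diff_cancel_right' diff_self)
  finally have "(A - catalan_fps) * (1 - fps_X * (A + catalan_fps)) = 0" .
  moreover have "fps_nth (1 - fps_X * (A + catalan_fps)) 0 = 1"
    by simp
  hence "1 - fps_X * (A + catalan_fps) \<noteq> 0"
    by (metis fps_zero_nth zero_neq_one)
  ultimately show ?thesis by simp
qed

text \<open>
  Keeping the true coefficient at \<open>n = 0\<close> makes the case \<open>k = 0\<close> the Catalan series, from which the
  induction on \<open>k\<close> can start.
\<close>

definition decreasing_fps :: "nat \<Rightarrow> real fps" where
  "decreasing_fps k = Abs_fps (\<lambda>n. of_nat (num_132_decreasing k n))"

lemma decreasing_fps_0: "decreasing_fps 0 = catalan_fps"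
proof (rule eq_catalan_fpsI, rule fps_ext)
  fix n
  show "fps_nth (decreasing_fps 0) n = fps_nth (1 + fps_X * decreasing_fps 0 ^ 2) n"
  proof (cases n)
    case (Suc m)
    have "fps_nth (decreasing_fps 0 ^ 2) m = fps_nth (decreasing_fps 0) n"
      unfolding Suc power2_eq_square fps_mult_nth
      by (simp add: decreasing_fps_def num_132_decreasing_0_Suc atLeast0AtMost)
    thus ?thesis by (simp add: Suc)
  qed (simp add: decreasing_fps_def num_132_decreasing_0_0)
qed

lemma decreasing_fps_Suc_rec:
  "decreasing_fps (Suc k) = fps_X * decreasing_fps k + fps_X * (decreasing_fps (Suc k) * catalan_fps)"
  unfolding decreasing_fps_0[symmetric]
proof (rule fps_ext)
  fix n
  show "fps_nth (decreasing_fps (Suc k)) n = fps_nth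
    (fps_X * decreasing_fps k + fps_X * (decreasing_fps (Suc k) * decreasing_fps 0)) n"
  proof (cases n)
    case (Suc m)
    have "fps_nth (decreasing_fps k) m + fps_nth (decreasing_fps (Suc k) * decreasing_fps 0) m =
        fps_nth (decreasing_fps (Suc k)) n"
      unfolding Suc fps_mult_nth
      by (simp add: decreasing_fps_def num_132_decreasing_Suc_Suc atLeast0AtMost)
    thus ?thesis by (simp add: Suc)
  qed (simp add: decreasing_fps_def num_132_decreasing_Suc_0)
qed

text \<open>Solve the linear equation for \<open>A\<^bsub>k+1\<^esub>\<close>, using that \<open>C\<close> is the inverse of \<open>1 - x C\<close>.\<close>

lemma decreasing_fps_Suc: "decreasing_fps (Suc k) = fps_X * catalan_fps * decreasing_fps k"
proof -
  let ?A = "decreasing_fps (Suc k)" and ?C = catalan_fps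
  have "?A = ?A * (?C - fps_X * ?C ^ 2)"
    using catalan_fps_eq by (metis add_diff_cancel_right' mult.right_neutral)
  also have "\<dots> = (?A - fps_X * (?A * ?C)) * ?C"
    by (simp add: algebra_simps power2_eq_square)
  also have "?A - fps_X * (?A * ?C) = fps_X * decreasing_fps k"
    using decreasing_fps_Suc_rec[of k] by (metis add_diff_cancel_right')
  finally show ?thesis by (simp add: mult_ac)
qed

lemma decreasing_fps_eq: "decreasing_fps k = fps_X ^ k * catalan_fps ^ (k + 1)"
  by (induction k) (simp_all add: decreasing_fps_0 decreasing_fps_Suc mult_ac)

theorem proposition5:
  fixes k :: nat
  assumes "k \<ge> 1"
  shows "G_132_decreasing k = fps_X ^ k * catalan_fps ^ (k + 1)"
proof -
  obtain j where "k = Suc j" using assms by (cases k) auto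
  hence "G_132_decreasing k = decreasing_fps k"
    by (auto simp: G_132_decreasing_def decreasing_fps_def num_132_decreasing_Suc_0 fps_eq_iff)
  thus ?thesis by (simp add: decreasing_fps_eq)
qed

end
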